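(* Let $\varepsilon>0$ and let $\alpha=(\alpha_0,\alpha_1,\dots)\in\ell^2$. Suppose $$\sum_{k\ge 2}(k+1)^2\left[\log(k+1)\right]^2\left[\log(\log(k+1))\right]^{2+\varepsilon}|\alpha_k|^2<+\infty.$$ Then the CAR-valued Foguel-Hankel operator $$R(Y_\alpha)=R(S^{*(\infty)},S^{(\infty)};Y_\alpha)=\begin{bmatrix} S^{*(\infty)} & Y_\alpha\\ 0 & S^{(\infty)}\end{bmatrix}$$ is similar to a contraction.
   Context: $H$ is a separable infinite-dimensional complex Hilbert space with inner product $(\cdot,\cdot)$, and $B(H)$ denotes the bounded linear operators on $H$. $\Lambda:H\to B(H)$ is a map satisfying the canonical anticommutation relations (CAR): for all $u,v\in H$, $\Lambda(u)\Lambda(v)+\Lambda(v)\Lambda(u)=0$ and $\Lambda(u)\Lambda(v)^*+\Lambda(v)^*\Lambda(u)=(u,v)I$. $\{e_n\}_{n\ge 0}$ is an orthonormal basis of $H$ and $C_n=\Lambda(e_n)$ for $n\ge 0$. For a sequence $\alpha\in\ell^2$, $Y_\alpha=[\alpha_{i+j}C_{i+j}]_{i,j\ge 0}$ is the CAR-valued Hankel operator acting on $\ell_2(H)$, the Hilbert space of square-summable sequences in $H$ (operator matrices act by $(Xh)_i=\sum_j X_{ij}h_j$). $S^{(\infty)}$ is the unilateral shift on $\ell_2(H)$, $S^{(\infty)}(h_0,h_1,\dots)=(0,h_0,h_1,\dots)$, and $S^{*(\infty)}$ is its adjoint; $R(Y_\alpha)$ acts on $\ell_2(H)\oplus\ell_2(H)$.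 An operator $T\in B(K)$ is similar to a contraction if there is an invertible $L\in B(K)$ with $\|L^{-1}TL\|\le 1$. *)

theory Defs
  imports "HOL-Analysis.Analysis"
begin

section \<open>Complex Hilbert spaces\<close>

text \<open>
  A complex inner product space is a real inner product space with a compatible complex structure.
  The inner product is linear in its first argument, and the real inner product is its real part,
  so that \<open>norm x = sqrt (Re (cinner x x))\<close>. (The remaining vector space law
  \<open>scaleC 1 x = x\<close> follows from \<open>scaleR_scaleC\<close>.)
\<close>

class complex_inner = real_inner +
  fixes scaleC :: "complex \<Rightarrow> 'a \<Rightarrow> 'a" (infixr \<open>*\<^sub>C\<close> 75)
    and cinner :: "'a \<Rightarrow> 'a \<Rightarrow> complex"
  assumes scaleC_add_right: "a *\<^sub>C (x + y) = a *\<^sub>C x + a *\<^sub>C y"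
    and scaleC_add_left: "(a + b) *\<^sub>C x = a *\<^sub>C x + b *\<^sub>C x"
    and scaleC_scaleC: "a *\<^sub>C (b *\<^sub>C x) = (a * b) *\<^sub>C x"
    and scaleR_scaleC: "scaleR r x = complex_of_real r *\<^sub>C x"
    and cinner_commute: "cinner x y = cnj (cinner y x)"
    and cinner_add_left: "cinner (x + y) z = cinner x z + cinner y z"
    and cinner_scaleC_left: "cinner (a *\<^sub>C x) y = a * cinner x y"
    and inner_eq_Re_cinner: "inner x y = Re (cinner x y)"

class chilbert_space = complex_inner + complete_space

lemma vector_space_scaleC: "vector_space (scaleC :: complex \<Rightarrow> 'a \<Rightarrow> 'a::complex_inner)"
proof
  fix x :: 'a
  show "1 *\<^sub>C x = x"
    using scaleR_scaleC[of 1 x] by simp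
qed (simp_all add: scaleC_add_right scaleC_add_left scaleC_scaleC)

lemma cinner_self: "cinner x x = complex_of_real ((norm x)\<^sup>2)" for x :: "'a::complex_inner"
proof -
  have "Im (cinner x x) = 0"
    using arg_cong[OF cinner_commute[of x x], of Im] by simp
  moreover have "Re (cinner x x) = (norm x)\<^sup>2"
    by (simp add: power2_norm_eq_inner flip: inner_eq_Re_cinner)
  ultimately show ?thesis
    by (simp add: complex_eq_iff)
qed

lemma norm_scaleC: "norm (a *\<^sub>C x) = cmod a * norm x" for x :: "'a::complex_inner"
proof -
  have "cinner (a *\<^sub>C x) (a *\<^sub>C x) = a * cinner x (a *\<^sub>C x)"
    by (rule cinner_scaleC_left)
  also have "cinner x (a *\<^sub>C x) = cnj (a * cinner x x)"
    unfolding cinner_scaleC_left[symmetric] by (rule cinner_commute)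
  also have "a * cnj (a * cinner x x) = (a * cnj a) * complex_of_real ((norm x)\<^sup>2)"
    unfolding cinner_self by (simp only: complex_cnj_mult complex_cnj_complex_of_real mult.assoc)
  also have "\<dots> = complex_of_real ((cmod a * norm x)\<^sup>2)"
    by (simp only: complex_norm_square[symmetric] power_mult_distrib of_real_mult)
  finally have "complex_of_real ((norm (a *\<^sub>C x))\<^sup>2) = complex_of_real ((cmod a * norm x)\<^sup>2)"
    unfolding cinner_self .
  then have "(norm (a *\<^sub>C x))\<^sup>2 = (cmod a * norm x)\<^sup>2"
    using of_real_eq_iff by blast
  then show ?thesis
    by (simp add: power2_eq_iff_nonneg)
qed

instantiation prod :: (complex_inner, complex_inner) complex_inner
begin

definition scaleC_prod_def: "a *\<^sub>C p = (a *\<^sub>C fst p, a *\<^sub>C snd p)"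

definition cinner_prod_def: "cinner p q = cinner (fst p) (fst q) + cinner (snd p) (snd q)"

instance
proof
  fix x y :: "'a \<times> 'b"
  show "cinner x y = cnj (cinner y x)"
    by (simp add: cinner_prod_def cinner_commute[of "fst x"] cinner_commute[of "snd x"])
qed (simp_all add: scaleC_prod_def cinner_prod_def inner_prod_def prod_eq_iff scaleC_add_right
    scaleC_add_left scaleC_scaleC scaleR_scaleC cinner_add_left cinner_scaleC_left
    inner_eq_Re_cinner algebra_simps)

end

instance prod :: (chilbert_space, chilbert_space) chilbert_space ..

section \<open>Square-summable sequences of vectors\<close>

typedef (overloaded) 'a l2 = "{h :: nat \<Rightarrow> 'a::real_inner. summable (\<lambda>n. (norm (h n))\<^sup>2)}"
  morphisms coord Abs_l2
  by (rule exI[of _ "\<lambda>_. 0"]) simp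

setup_lifting type_definition_l2

lemma summable_coord: "summable (\<lambda>n. (norm (coord h n))\<^sup>2)"
  using coord by blast

lemma l2_eqI: "(\<And>n. coord f n = coord g n) \<Longrightarrow> f = g"
  by (metis coord_inject ext)

lemma square_summable_add:
  fixes f g :: "nat \<Rightarrow> 'a::real_inner"
  assumes "summable (\<lambda>n. (norm (f n))\<^sup>2)" "summable (\<lambda>n. (norm (g n))\<^sup>2)"
  shows "summable (\<lambda>n. (norm (f n + g n))\<^sup>2)"
proof (rule summable_comparison_test')
  show "summable (\<lambda>n. 2 * (norm (f n))\<^sup>2 + 2 * (norm (g n))\<^sup>2)"
    using assms by (intro summable_add summable_mult)
  fix n
  have "(norm (f n + g n))\<^sup>2 \<le> (norm (f n) + norm (g n))\<^sup>2"
    by (intro power_mono norm_triangle_ineq) auto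
  also have "\<dots> \<le> 2 * (norm (f n))\<^sup>2 + 2 * (norm (g n))\<^sup>2"
    using sum_squares_bound[of "norm (f n)" "norm (g n)"]
    by (simp add: power2_sum)
  finally show "norm ((norm (f n + g n))\<^sup>2) \<le> 2 * (norm (f n))\<^sup>2 + 2 * (norm (g n))\<^sup>2"
    by simp
qed

lemma square_summable_scaleR:
  fixes f :: "nat \<Rightarrow> 'a::real_inner"
  assumes "summable (\<lambda>n. (norm (f n))\<^sup>2)"
  shows "summable (\<lambda>n. (norm (r *\<^sub>R f n))\<^sup>2)"
  using summable_mult[OF assms, of "r\<^sup>2"] by (simp add: power_mult_distrib)

lemma square_summable_scaleC:
  fixes f :: "nat \<Rightarrow> 'a::complex_inner"
  assumes "summable (\<lambda>n. (norm (f n))\<^sup>2)"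
  shows "summable (\<lambda>n. (norm (a *\<^sub>C f n))\<^sup>2)"
  using summable_mult[OF assms, of "(cmod a)\<^sup>2"] by (simp add: power_mult_distrib norm_scaleC)

lemma square_summable_mult:
  fixes f g :: "nat \<Rightarrow> 'a::real_inner"
  assumes "summable (\<lambda>n. (norm (f n))\<^sup>2)" "summable (\<lambda>n. (norm (g n))\<^sup>2)"
  shows "summable (\<lambda>n. norm (f n) * norm (g n))"
proof (rule summable_comparison_test')
  show "summable (\<lambda>n. (norm (f n))\<^sup>2 + (norm (g n))\<^sup>2)"
    using assms by (intro summable_add)
  fix n
  have "2 * (norm (f n) * norm (g n)) \<le> (norm (f n))\<^sup>2 + (norm (g n))\<^sup>2"
    using sum_squares_bound[of "norm (f n)" "norm (g n)"] by simp
  moreover have "0 \<le> norm (f n) * norm (g n)"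
    by simp
  ultimately show "norm (norm (f n) * norm (g n)) \<le> (norm (f n))\<^sup>2 + (norm (g n))\<^sup>2"
    unfolding real_norm_def by linarith
qed

lemma summable_inner_coord: "summable (\<lambda>n. inner (coord f n) (coord g n))"
  by (rule summable_comparison_test'[OF square_summable_mult[OF summable_coord[of f] summable_coord[of g]]])
     (simp add: Cauchy_Schwarz_ineq2)

lemma cnj_sgn_mult_self: "cnj (sgn z) * z = complex_of_real (cmod z)"
proof (cases "z = 0")
  case False
  have "cnj (sgn z) * z = complex_of_real (inverse (cmod z)) * (z * cnj z)"
    by (simp only: sgn_div_norm scaleR_conv_of_real complex_cnj_mult complex_cnj_complex_of_real
        mult.assoc mult.commute[of "cnj z" z])
  also have "\<dots> = complex_of_real (inverse (cmod z) * (cmod z)\<^sup>2)"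
    by (simp only: complex_norm_square[symmetric] of_real_mult)
  also have "inverse (cmod z) * (cmod z)\<^sup>2 = cmod z"
    using False by (simp add: power2_eq_square)
  finally show ?thesis .
qed simp

lemma norm_cinner_le: "cmod (cinner x y) \<le> norm x * norm y" for x y :: "'a::complex_inner"
proof (cases "cinner x y = 0")
  case False
  define u where "u = cnj (sgn (cinner x y))"
  have "cmod (cinner x y) = Re (cinner (u *\<^sub>C x) y)"
    by (simp add: u_def cinner_scaleC_left cnj_sgn_mult_self)
  also have "\<dots> \<le> norm (u *\<^sub>C x) * norm y"
    unfolding inner_eq_Re_cinner[symmetric] by (rule norm_cauchy_schwarz)
  also have "norm (u *\<^sub>C x) = norm x"
    using False by (simp add: u_def norm_scaleC norm_sgn)
  finally show ?thesis .
qed simp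

lemma summable_cinner_coord: "summable (\<lambda>n. cinner (coord f n) (coord g n))"
  for f g :: "'a::complex_inner l2"
  by (rule summable_comparison_test'[OF square_summable_mult[OF summable_coord[of f] summable_coord[of g]]])
     (simp add: norm_cinner_le)

instantiation l2 :: (real_inner) real_normed_vector
begin

lift_definition zero_l2 :: "'a l2" is "\<lambda>_. 0"
  by simp

lift_definition plus_l2 :: "'a l2 \<Rightarrow> 'a l2 \<Rightarrow> 'a l2" is "\<lambda>f g n. f n + g n"
  by (rule square_summable_add)

lift_definition uminus_l2 :: "'a l2 \<Rightarrow> 'a l2" is "\<lambda>f n. - f n"
  by simp

lift_definition minus_l2 :: "'a l2 \<Rightarrow> 'a l2 \<Rightarrow> 'a l2" is "\<lambda>f g n. f n - g n"
  subgoal for f g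
    using square_summable_add[of f "\<lambda>n. - g n"] by simp
  done

lift_definition scaleR_l2 :: "real \<Rightarrow> 'a l2 \<Rightarrow> 'a l2" is "\<lambda>r f n. r *\<^sub>R f n"
  by (rule square_summable_scaleR)

definition norm_l2 :: "'a l2 \<Rightarrow> real"
  where "norm f = sqrt (\<Sum>n. (norm (coord f n))\<^sup>2)"

definition sgn_l2 :: "'a l2 \<Rightarrow> 'a l2"
  where "sgn_l2 f = inverse (norm f) *\<^sub>R f"

definition dist_l2 :: "'a l2 \<Rightarrow> 'a l2 \<Rightarrow> real"
  where "dist_l2 f g = norm (f - g)"

definition uniformity_l2 :: "('a l2 \<times> 'a l2) filter"
  where "uniformity_l2 = (INF e\<in>{0 <..}. principal {(f :: 'a l2, g). dist f g < e})"

definition open_l2 :: "'a l2 set \<Rightarrow> bool"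
  where "open_l2 U \<longleftrightarrow> (\<forall>f\<in>U. \<forall>\<^sub>F (f', g) in uniformity. f' = f \<longrightarrow> g \<in> U)"

instance
proof
  fix f g h :: "'a l2" and r s :: real
  show "f + g + h = f + (g + h)" by transfer (simp add: add.assoc)
  show "f + g = g + f" by transfer (simp add: add.commute)
  show "0 + f = f" by transfer simp
  show "- f + f = 0" by transfer simp
  show "f - g = f + - g" by transfer simp
  show "r *\<^sub>R (f + g) = r *\<^sub>R f + r *\<^sub>R g" by transfer (simp add: scaleR_add_right)
  show "(r + s) *\<^sub>R f = r *\<^sub>R f + s *\<^sub>R f" by transfer (simp add: scaleR_add_left)
  show "r *\<^sub>R s *\<^sub>R f = (r * s) *\<^sub>R f" by transfer simp
  show "1 *\<^sub>R f = f" by transfer simp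
  show "dist f g = norm (f - g)" by (rule dist_l2_def)
  show "sgn f = inverse (norm f) *\<^sub>R f" by (rule sgn_l2_def)
  show "(uniformity :: ('a l2 \<times> 'a l2) filter) = (INF e\<in>{0 <..}. principal {(f, g). dist f g < e})"
    by (rule uniformity_l2_def)
  show "open U \<longleftrightarrow> (\<forall>f\<in>U. \<forall>\<^sub>F (f', g) in uniformity. f' = f \<longrightarrow> g \<in> U)" for U :: "'a l2 set"
    by (rule open_l2_def)
  show "norm f = 0 \<longleftrightarrow> f = 0"
    by (auto simp: norm_l2_def suminf_eq_zero_iff[OF summable_coord] zero_l2.rep_eq
        intro: l2_eqI)
  show "norm (r *\<^sub>R f) = \<bar>r\<bar> * norm f"
    by (simp add: norm_l2_def scaleR_l2.rep_eq power_mult_distrib suminf_mult summable_coord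
        real_sqrt_mult)
  have partial: "L2_set (\<lambda>n. norm (coord k n)) {..<N} \<le> norm k" for k :: "'a l2" and N
    unfolding L2_set_def norm_l2_def
    by (intro real_sqrt_le_mono sum_le_suminf summable_coord) auto
  have nonneg: "0 \<le> norm k" for k :: "'a l2"
    using partial[of k 0] by simp
  have "(\<Sum>n<N. (norm (coord (f + g) n))\<^sup>2) \<le> (norm f + norm g)\<^sup>2" for N
  proof -
    have "L2_set (\<lambda>n. norm (coord (f + g) n)) {..<N}
        \<le> L2_set (\<lambda>n. norm (coord f n) + norm (coord g n)) {..<N}"
      by (intro L2_set_mono) (auto simp: plus_l2.rep_eq norm_triangle_ineq)
    also have "\<dots> \<le> L2_set (\<lambda>n. norm (coord f n)) {..<N} + L2_set (\<lambda>n. norm (coord g n)) {..<N}"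
      by (rule L2_set_triangle_ineq)
    also have "\<dots> \<le> norm f + norm g"
      by (intro add_mono partial)
    finally show ?thesis
      unfolding L2_set_def using real_sqrt_le_iff sqrt_le_D by blast
  qed
  then have "(\<Sum>n. (norm (coord (f + g) n))\<^sup>2) \<le> (norm f + norm g)\<^sup>2"
    by (intro suminf_le_const summable_coord)
  then show "norm (f + g) \<le> norm f + norm g"
    unfolding norm_l2_def[of "f + g"] using nonneg[of f] nonneg[of g] by (simp add: real_le_lsqrt)
qed

end

instantiation l2 :: (real_inner) real_inner
begin

definition inner_l2 :: "'a l2 \<Rightarrow> 'a l2 \<Rightarrow> real"
  where "inner f g = (\<Sum>n. inner (coord f n) (coord g n))"

instance
proof
  fix f g h :: "'a l2" and r :: real
  show norm: "norm f = sqrt (inner f f)" for f :: "'a l2"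
    by (simp add: norm_l2_def inner_l2_def power2_norm_eq_inner)
  show "inner f g = inner g f" by (simp add: inner_l2_def inner_commute)
  show "inner (f + g) h = inner f h + inner g h"
    by (simp add: inner_l2_def plus_l2.rep_eq inner_add_left suminf_add summable_inner_coord)
  show "inner (r *\<^sub>R f) g = r * inner f g"
    by (simp add: inner_l2_def scaleR_l2.rep_eq suminf_mult summable_inner_coord)
  show "0 \<le> inner f f"
    by (simp add: inner_l2_def suminf_nonneg summable_inner_coord)
  show "inner f f = 0 \<longleftrightarrow> f = 0"
    using norm[of f] by (metis norm_eq_zero real_sqrt_eq_zero_cancel_iff)
qed

end

lemma norm_l2_power2: "(norm f)\<^sup>2 = (\<Sum>n. (norm (coord f n))\<^sup>2)" for f :: "'a::real_inner l2"
  by (simp add: power2_norm_eq_inner inner_l2_def)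

lemma sum_coord_le_norm: "(\<Sum>n<N. (norm (coord f n))\<^sup>2) \<le> (norm f)\<^sup>2" for f :: "'a::real_inner l2"
  unfolding norm_l2_power2 by (intro sum_le_suminf summable_coord) auto

lemma norm_coord_le: "norm (coord f n) \<le> norm f" for f :: "'a::real_inner l2"
proof -
  have "(norm (coord f n))\<^sup>2 \<le> (\<Sum>k<Suc n. (norm (coord f k))\<^sup>2)"
    by (simp add: sum_nonneg)
  also have "\<dots> \<le> (norm f)\<^sup>2"
    by (rule sum_coord_le_norm)
  finally show ?thesis
    by (rule power2_le_imp_le) simp
qed

instantiation l2 :: (complex_inner) complex_inner
begin

lift_definition scaleC_l2 :: "complex \<Rightarrow> 'a l2 \<Rightarrow> 'a l2" is "\<lambda>a f n. a *\<^sub>C f n"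
  by (rule square_summable_scaleC)

definition cinner_l2 :: "'a l2 \<Rightarrow> 'a l2 \<Rightarrow> complex"
  where "cinner f g = (\<Sum>n. cinner (coord f n) (coord g n))"

instance
proof
  fix f g h :: "'a l2" and r :: real and a b :: complex
  show "a *\<^sub>C (f + g) = a *\<^sub>C f + a *\<^sub>C g" by transfer (simp add: scaleC_add_right)
  show "(a + b) *\<^sub>C f = a *\<^sub>C f + b *\<^sub>C f" by transfer (simp add: scaleC_add_left)
  show "a *\<^sub>C (b *\<^sub>C f) = (a * b) *\<^sub>C f" by transfer (simp add: scaleC_scaleC)
  show "r *\<^sub>R f = complex_of_real r *\<^sub>C f" by transfer (simp add: scaleR_scaleC)
  have "(\<lambda>n. cnj (cinner (coord g n) (coord f n))) sums cnj (cinner g f)"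
    unfolding cinner_l2_def sums_cnj by (intro summable_sums summable_cinner_coord)
  moreover have "cnj (cinner (coord g n) (coord f n)) = cinner (coord f n) (coord g n)" for n
    by (rule cinner_commute[symmetric])
  ultimately show "cinner f g = cnj (cinner g f)"
    unfolding cinner_l2_def[of f g] by (simp only: sums_iff)
  show "cinner (f + g) h = cinner f h + cinner g h"
    by (simp add: cinner_l2_def plus_l2.rep_eq cinner_add_left suminf_add summable_cinner_coord)
  show "cinner (a *\<^sub>C f) g = a * cinner f g"
    by (simp add: cinner_l2_def scaleC_l2.rep_eq cinner_scaleC_left suminf_mult
        summable_cinner_coord)
  show "inner f g = Re (cinner f g)"
    by (simp add: inner_l2_def cinner_l2_def inner_eq_Re_cinner Re_suminf summable_cinner_coord)
qed

end

instance l2 :: (chilbert_space) chilbert_space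
proof
  fix X :: "nat \<Rightarrow> 'a l2"
  assume X: "Cauchy X"
  have "Cauchy (\<lambda>m. coord (X m) n)" for n
  proof (rule metric_CauchyI)
    fix e :: real assume "e > 0"
    then obtain M where M: "\<And>m k. m \<ge> M \<Longrightarrow> k \<ge> M \<Longrightarrow> dist (X m) (X k) < e"
      using metric_CauchyD[OF X] by blast
    have "dist (coord (X m) n) (coord (X k) n) \<le> dist (X m) (X k)" for m k
      using norm_coord_le[of "X m - X k" n] by (simp add: dist_norm minus_l2.rep_eq)
    then have "dist (coord (X m) n) (coord (X k) n) < e" if "m \<ge> M" "k \<ge> M" for m k
      using M[OF that] by (rule le_less_trans)
    then show "\<exists>M. \<forall>m\<ge>M. \<forall>k\<ge>M. dist (coord (X m) n) (coord (X k) n) < e"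
      by blast
  qed
  then have "\<exists>l. (\<lambda>m. coord (X m) n) \<longlonglongrightarrow> l" for n
    using Cauchy_convergent convergent_def by blast
  then obtain g where g: "\<And>n. (\<lambda>m. coord (X m) n) \<longlonglongrightarrow> g n"
    by metis
  have tail: "(\<Sum>n<N. (norm (coord (X m) n - g n))\<^sup>2) \<le> e\<^sup>2"
    if M: "\<And>m k. m \<ge> M \<Longrightarrow> k \<ge> M \<Longrightarrow> dist (X m) (X k) < e" and m: "m \<ge> M" for N M m e
  proof (rule LIMSEQ_le_const2)
    show "(\<lambda>k. \<Sum>n<N. (norm (coord (X m) n - coord (X k) n))\<^sup>2)
        \<longlonglongrightarrow> (\<Sum>n<N. (norm (coord (X m) n - g n))\<^sup>2)"
      by (intro tendsto_intros g)
    have "(\<Sum>n<N. (norm (coord (X m) n - coord (X k) n))\<^sup>2) \<le> e\<^sup>2" if "k \<ge> M" for k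
    proof -
      have "(\<Sum>n<N. (norm (coord (X m) n - coord (X k) n))\<^sup>2) \<le> (norm (X m - X k))\<^sup>2"
        using sum_coord_le_norm[of "X m - X k"] by (simp add: minus_l2.rep_eq)
      also have "\<dots> \<le> e\<^sup>2"
        using M[OF m that] by (intro power_mono) (auto simp: dist_norm)
      finally show ?thesis .
    qed
    then show "\<exists>K. \<forall>k\<ge>K. (\<Sum>n<N. (norm (coord (X m) n - coord (X k) n))\<^sup>2) \<le> e\<^sup>2"
      by blast
  qed
  have summ: "summable (\<lambda>n. (norm (coord (X m) n - g n))\<^sup>2)"
    if "\<And>m k. m \<ge> M \<Longrightarrow> k \<ge> M \<Longrightarrow> dist (X m) (X k) < e" and "m \<ge> M" for M m e
    by (rule summableI_nonneg_bounded[OF _ tail[where M = M and e = e, OF that]]) simp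
  obtain M1 where M1: "\<And>m k. m \<ge> M1 \<Longrightarrow> k \<ge> M1 \<Longrightarrow> dist (X m) (X k) < 1"
    using metric_CauchyD[OF X zero_less_one] by blast
  define d where "d = (\<lambda>n. - (coord (X M1) n - g n))"
  have "summable (\<lambda>n. (norm (d n))\<^sup>2)"
    unfolding d_def norm_minus_cancel by (rule summ[where M = M1 and e = 1, OF M1 order_refl])
  then have "summable (\<lambda>n. (norm (coord (X M1) n + d n))\<^sup>2)"
    by (rule square_summable_add[OF summable_coord])
  moreover have "coord (X M1) n + d n = g n" for n
    by (simp add: d_def)
  ultimately have "summable (\<lambda>n. (norm (g n))\<^sup>2)"
    by (simp only:)
  then have G: "coord (Abs_l2 g) = g"
    by (simp add: Abs_l2_inverse)
  have "X \<longlonglongrightarrow> Abs_l2 g"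
  proof (rule metric_LIMSEQ_I)
    fix e :: real assume e: "e > 0"
    then obtain M where M: "\<And>m k. m \<ge> M \<Longrightarrow> k \<ge> M \<Longrightarrow> dist (X m) (X k) < e / 2"
      using metric_CauchyD[OF X half_gt_zero[OF e]] by blast
    have "dist (X m) (Abs_l2 g) < e" if m: "m \<ge> M" for m
    proof -
      have "(norm (X m - Abs_l2 g))\<^sup>2 \<le> (e / 2)\<^sup>2"
        unfolding norm_l2_power2 minus_l2.rep_eq G
        by (rule suminf_le_const[OF summ[where M = M and e = "e / 2", OF M m]
              tail[where M = M and e = "e / 2", OF M m]])
      then have "norm (X m - Abs_l2 g) \<le> e / 2"
        by (rule power2_le_imp_le) (use e in simp)
      then show ?thesis
        using e by (simp add: dist_norm)
    qed
    then show "\<exists>M. \<forall>m\<ge>M. dist (X m) (Abs_l2 g) < e"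
      by blast
  qed
  then show "convergent X"
    by (auto simp: convergent_def)
qed

section \<open>Operators\<close>

definition bounded_clinear :: "('a::complex_inner \<Rightarrow> 'b::complex_inner) \<Rightarrow> bool"
  where "bounded_clinear T \<longleftrightarrow> bounded_linear T \<and> (\<forall>a x. T (a *\<^sub>C x) = a *\<^sub>C T x)"

text \<open>By the Riesz representation theorem the adjoint is defined for every bounded operator on a
  Hilbert space; it is unique by definiteness of the inner product.\<close>

definition cadjoint :: "('a::chilbert_space \<Rightarrow> 'b::chilbert_space) \<Rightarrow> 'b \<Rightarrow> 'a"
  where "cadjoint T = (THE S. \<forall>x y. cinner (T x) y = cinner x (S y))"

text \<open>The operator norm of \<open>T\<close> is \<open>onorm T\<close>, which does not depend on the scalar field.\<close>

definition similar_to_contraction :: "('k::chilbert_space \<Rightarrow> 'k) \<Rightarrow> bool"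
  where "similar_to_contraction T \<longleftrightarrow>
    bounded_clinear T \<and>
    (\<exists>(L :: 'k \<Rightarrow> 'k) (L' :: 'k \<Rightarrow> 'k). bounded_clinear L \<and> bounded_clinear L' \<and> L \<circ> L' = id \<and> L' \<circ> L = id \<and>
      onorm (L' \<circ> T \<circ> L) \<le> 1)"

definition is_CAR_map :: "('a::chilbert_space \<Rightarrow> 'a \<Rightarrow> 'a) \<Rightarrow> bool"
  where "is_CAR_map \<Lambda> \<longleftrightarrow>
    (\<forall>u. bounded_clinear (\<Lambda> u)) \<and>
    (\<forall>u v x. \<Lambda> u (\<Lambda> v x) + \<Lambda> v (\<Lambda> u x) = 0) \<and>
    (\<forall>u v x. \<Lambda> u (cadjoint (\<Lambda> v) x) + cadjoint (\<Lambda> v) (\<Lambda> u x) = cinner u v *\<^sub>C x)"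

text \<open>A space with an orthonormal basis indexed by \<^typ>\<open>nat\<close> is separable and
  infinite-dimensional.\<close>

definition is_orthonormal_basis :: "(nat \<Rightarrow> 'a::chilbert_space) \<Rightarrow> bool"
  where "is_orthonormal_basis e \<longleftrightarrow>
    (\<forall>m n. cinner (e m) (e n) = (if m = n then 1 else 0)) \<and>
    closure (module.span scaleC (range e)) = UNIV"

text \<open>The value at \<open>h\<close> is meaningful only if the series converge and the resulting sequence is
  square-summable.\<close>

definition matrix_op :: "(nat \<Rightarrow> nat \<Rightarrow> 'a::chilbert_space \<Rightarrow> 'a) \<Rightarrow> 'a l2 \<Rightarrow> 'a l2"
  where "matrix_op X h = Abs_l2 (\<lambda>i. \<Sum>j. X i j (coord h j))"

text \<open>If \<open>\<Lambda>\<close> satisfies the CAR, \<open>e\<close> is orthonormal and \<open>\<alpha>\<close> is square-summable, then this matrix is a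
  bounded operator: its operator-valued symbol \<open>\<Sum>k. \<alpha> k z\<^sup>k \<Lambda> (e k)\<close> satisfies \<open>T T* + T* T = c I\<close>
  with \<open>c = \<Sum>k. |\<alpha> k|\<^sup>2\<close> for every \<open>z\<close> on the unit circle, hence is bounded by \<open>sqrt c\<close>.\<close>

definition CAR_hankel ::
    "('a::chilbert_space \<Rightarrow> 'a \<Rightarrow> 'a) \<Rightarrow> (nat \<Rightarrow> 'a) \<Rightarrow> (nat \<Rightarrow> complex) \<Rightarrow> 'a l2 \<Rightarrow> 'a l2"
  where "CAR_hankel \<Lambda> e \<alpha> = matrix_op (\<lambda>i j x. \<alpha> (i + j) *\<^sub>C \<Lambda> (e (i + j)) x)"

lift_definition shift :: "'a::real_inner l2 \<Rightarrow> 'a l2"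
  is "\<lambda>h n. case n of 0 \<Rightarrow> 0 | Suc m \<Rightarrow> h m"
  by (subst summable_Suc_iff[symmetric]) simp

lemma cadjoint_eqI:
  assumes "\<And>x y. cinner (T x) y = cinner x (S y)"
  shows "cadjoint T = S"
  unfolding cadjoint_def
proof (rule the_equality)
  show "\<forall>x y. cinner (T x) y = cinner x (S y)"
    using assms by blast
next
  fix S' assume S': "\<forall>x y. cinner (T x) y = cinner x (S' y)"
  show "S' = S"
  proof
    fix y
    have "cinner x (S' y) = cinner x (S y)" for x
      using S' assms by metis
    then have "inner x (S' y) = inner x (S y)" for x
      by (simp add: inner_eq_Re_cinner)
    then have "inner x (S' y - S y) = 0" for x
      by (simp add: inner_diff_right)
    then have "inner (S' y - S y) (S' y - S y) = 0" .
    then show "S' y = S y"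
      by simp
  qed
qed

lemma coord_cadjoint_shift: "coord (cadjoint shift h) n = coord h (Suc n)"
proof -
  define B where "B = (\<lambda>h :: 'a l2. Abs_l2 (\<lambda>n. coord h (Suc n)))"
  have B: "coord (B h) n = coord h (Suc n)" for h n
    unfolding B_def using summable_Suc_iff[of "\<lambda>n. (norm (coord h n))\<^sup>2"] summable_coord[of h]
    by (subst Abs_l2_inverse) simp_all
  have "cadjoint shift = B"
  proof (rule cadjoint_eqI)
    fix f g :: "'a l2"
    have "cinner 0 (coord g 0) = 0"
      using cinner_add_left[of 0 0 "coord g 0"] by simp
    then have "cinner (shift f) g = (\<Sum>n. cinner (coord (shift f) (Suc n)) (coord g (Suc n)))"
      unfolding cinner_l2_def
      by (subst suminf_split_head[OF summable_cinner_coord]) (simp add: shift.rep_eq)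
    then show "cinner (shift f) g = cinner f (B g)"
      by (simp add: cinner_l2_def B shift.rep_eq)
  qed
  then show ?thesis
    by (simp add: B)
qed

definition foguel ::
    "('a \<Rightarrow> 'a) \<Rightarrow> ('b \<Rightarrow> 'b) \<Rightarrow> ('b \<Rightarrow> 'a::plus) \<Rightarrow> 'a \<times> 'b \<Rightarrow> 'a \<times> 'b"
  where "foguel A B X = (\<lambda>(f, g). (A f + X g, B g))"

end

theory Submission
  imports Defs
begin

text \<open>
  Write \<open>S\<close> for the shift and \<open>Y\<close> for the CAR-valued Hankel operator. If a bounded \<open>X\<close> solves the
  commutator equation \<open>S* X - X S = - Y\<close>, then the unipotent matrix with corner \<open>X\<close> conjugates
  the Foguel operator into \<open>S* \<oplus> S\<close>, which is a contraction. As \<open>S* S = I\<close>, the series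
  \<open>X = \<Sum>m. S*\<^sup>m Y S*\<^sup>m\<^sup>+\<^sup>1\<close> solves the equation by telescoping, and it converges in norm as soon as
  the norms of \<open>S*\<^sup>m Y\<close> are summable (\<open>foguel_similar_to_contraction\<close>).

  The operator \<open>S*\<^sup>m Y\<close> is again a CAR-valued Hankel operator, with symbol \<open>\<alpha>\<close> shifted by \<open>m\<close>.
  Such an operator has norm at most the \<open>\<ell>\<^sup>2\<close> norm of its symbol: it is part of a Laurent matrix
  \<open>M\<close> for which the CAR make \<open>M* M + M M*\<close> a scalar (\<open>CAR_square_identity\<close>,
  \<open>norm_CAR_hankel_le\<close>). So the norm of \<open>S*\<^sup>m Y\<close> is at most the square root of the tail
  \<open>\<Sum>k\<ge>m. |\<alpha> k|\<^sup>2\<close>.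

  The weights in the hypothesis are increasing, so dividing by the weight at \<open>m\<close> bounds this square
  root by a constant multiple of \<open>1 / ((m+1) log (m+1) (log log (m+1))\<^sup>1\<^sup>+\<^sup>\<delta>)\<close> with
  \<open>\<delta> = \<epsilon> / 2\<close>. This is a term of a convergent Bertrand series (\<open>summable_bertrand\<close>).
\<close>

section \<open>Sesquilinear algebra\<close>

instance chilbert_space \<subseteq> banach ..

lemma cinner_add_right: "cinner x (y + z) = cinner x y + cinner x z" for x :: "'a::complex_inner"
  by (simp add: cinner_commute[of x] cinner_add_left)

lemma cinner_scaleC_right: "cinner x (a *\<^sub>C y) = cnj a * cinner x y" for x :: "'a::complex_inner"
  by (simp add: cinner_commute[of x] cinner_scaleC_left)

lemma cinner_zero_left [simp]: "cinner 0 x = 0" for x :: "'a::complex_inner"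
  using cinner_add_left[of 0 0 x] by simp

lemma bounded_linear_scaleC: "bounded_linear (\<lambda>x. a *\<^sub>C x :: 'a::complex_inner)"
proof (rule bounded_linear_intro)
  show "a *\<^sub>C r *\<^sub>R x = r *\<^sub>R a *\<^sub>C x" for r and x :: 'a
    by (simp add: scaleR_scaleC scaleC_scaleC mult.commute)
  show "norm (a *\<^sub>C x) \<le> norm x * cmod a" for x :: 'a
    by (simp add: norm_scaleC)
qed (rule scaleC_add_right)

lemma scaleC_zero_left [simp]: "0 *\<^sub>C x = (0 :: 'a::complex_inner)"
  using scaleR_scaleC[of 0 x] by simp

lemma scaleC_zero_right [simp]: "a *\<^sub>C 0 = (0 :: 'a::complex_inner)"
  using linear_0[OF bounded_linear.linear[OF bounded_linear_scaleC]] .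

lemma scaleC_minus_right: "a *\<^sub>C (- x) = - (a *\<^sub>C x :: 'a::complex_inner)"
  using linear_neg[OF bounded_linear.linear[OF bounded_linear_scaleC]] .

lemma bounded_clinearD:
  assumes "bounded_clinear T"
  shows "bounded_linear T" "T (a *\<^sub>C x) = a *\<^sub>C T x"
  using assms by (auto simp: bounded_clinear_def)

lemma bounded_clinear_intro:
  assumes "\<And>x y. T (x + y) = T x + T y" "\<And>a x. T (a *\<^sub>C x) = a *\<^sub>C T x"
    and "\<And>x. norm (T x) \<le> K * norm x"
  shows "bounded_clinear T"
  unfolding bounded_clinear_def using assms
  by (auto simp: scaleR_scaleC mult.commute[of K] intro!: bounded_linear_intro[where K = K])

section \<open>Adjoints of bounded operators\<close>

text \<open>
  The representing vector minimises \<open>\<phi> x = (norm x)\<^sup>2 - 2 * f x\<close>, since formally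
  \<open>\<phi> x = (norm (x - u))\<^sup>2 - (norm u)\<^sup>2\<close>. The parallelogram law makes minimising
  sequences Cauchy, and the first-order condition at the minimum is the representation of \<open>f\<close>.
\<close>

theorem Riesz_representation:
  fixes f :: "'a::{real_inner, complete_space} \<Rightarrow> real"
  assumes "bounded_linear f"
  shows "\<exists>u. \<forall>x. f x = inner x u"
proof -
  interpret f: bounded_linear f by fact
  obtain K where K: "\<And>x. norm (f x) \<le> norm x * K"
    using f.bounded by blast
  define \<phi> where "\<phi> x = (norm x)\<^sup>2 - 2 * f x" for x
  have lower: "- K\<^sup>2 \<le> \<phi> x" for x
  proof -
    have "f x \<le> norm x * K"
      using K[of x] by (simp add: abs_le_iff)
    then show ?thesis
      using zero_le_power2[of "norm x - K"] unfolding \<phi>_def power2_diff by linarith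
  qed
  then have bdd: "bdd_below (range \<phi>)"
    by (auto intro!: bdd_belowI)
  define m where "m = (INF x. \<phi> x)"
  have m: "m \<le> \<phi> x" for x
    unfolding m_def by (rule cINF_lower[OF bdd]) simp
  have "\<exists>x. \<phi> x < m + 1 / real (Suc n)" for n
    using cINF_less_iff[OF _ bdd, of "m + 1 / real (Suc n)"] by (auto simp: m_def)
  then obtain x where x: "\<And>n. \<phi> (x n) < m + 1 / real (Suc n)"
    by metis
  have mid: "(norm (y - z))\<^sup>2 = 2 * \<phi> y + 2 * \<phi> z - 4 * \<phi> ((1 / 2) *\<^sub>R (y + z))" for y z
    unfolding \<phi>_def by (simp add: power2_norm_eq_inner f.add f.scaleR f.diff inner_diff_left
        inner_diff_right inner_add_left inner_add_right inner_commute[of z y] algebra_simps)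
  have close: "(dist (x n) (x k))\<^sup>2 < 2 * (1 / real (Suc n)) + 2 * (1 / real (Suc k))" for n k
    using mid[of "x n" "x k"] m[of "(1 / 2) *\<^sub>R (x n + x k)"] x[of n] x[of k]
    unfolding dist_norm by linarith
  have d: "(dist (x n) (x k))\<^sup>2 < 4 * (1 / real (Suc M))" if "n \<ge> M" "k \<ge> M" for n k M
  proof -
    have "1 / real (Suc n) \<le> 1 / real (Suc M)" "1 / real (Suc k) \<le> 1 / real (Suc M)"
      using that by (auto intro!: divide_left_mono)
    then show ?thesis
      using close[of n k] by linarith
  qed
  have "Cauchy x"
  proof (rule metric_CauchyI)
    fix \<epsilon> :: real assume "\<epsilon> > 0"
    then obtain M where M: "inverse (real (Suc M)) < \<epsilon>\<^sup>2 / 4"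
      using reals_Archimedean[of "\<epsilon>\<^sup>2 / 4"] by auto
    have "dist (x n) (x k) < \<epsilon>" if "n \<ge> M" "k \<ge> M" for n k
    proof (rule power2_less_imp_less)
      show "(dist (x n) (x k))\<^sup>2 < \<epsilon>\<^sup>2"
        using d[OF that] M unfolding inverse_eq_divide by linarith
    qed (use \<open>\<epsilon> > 0\<close> in simp)
    then show "\<exists>M. \<forall>n\<ge>M. \<forall>k\<ge>M. dist (x n) (x k) < \<epsilon>"
      by blast
  qed
  then obtain u where u: "x \<longlonglongrightarrow> u"
    using Cauchy_convergent convergent_def by blast
  have "(\<lambda>n. \<phi> (x n)) \<longlonglongrightarrow> \<phi> u"
    unfolding \<phi>_def by (intro tendsto_intros f.tendsto u)
  moreover have "(\<lambda>n. m + 1 / real (Suc n)) \<longlonglongrightarrow> m + 0"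
    by (intro tendsto_intros LIMSEQ_Suc lim_1_over_n)
  ultimately have u_min: "\<phi> u \<le> m"
    using LIMSEQ_le[of "\<lambda>n. \<phi> (x n)" "\<phi> u" "\<lambda>n. m + 1 / real (Suc n)" "m + 0"] x
    by (auto intro: less_imp_le)
  have "f y = inner y u" for y
  proof -
    define c where "c = inner y u - f y"
    have ineq: "0 \<le> 2 * t * c + t\<^sup>2 * (norm y)\<^sup>2" for t
    proof -
      have "(norm (u + t *\<^sub>R y))\<^sup>2 = (norm u)\<^sup>2 + 2 * t * inner y u + t\<^sup>2 * (norm y)\<^sup>2"
        unfolding power2_norm_eq_inner inner_add_left inner_add_right inner_scaleR_left
          inner_scaleR_right inner_commute[of u y] power2_eq_square[of t]
        by (simp only: algebra_simps)
      then have "\<phi> (u + t *\<^sub>R y) = \<phi> u + (2 * t * c + t\<^sup>2 * (norm y)\<^sup>2)"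
        unfolding \<phi>_def c_def f.add f.scaleR by (simp only: real_scaleR_def algebra_simps)
      then show ?thesis
        using m[of "u + t *\<^sub>R y"] u_min by simp
    qed
    \<comment> \<open>A first-order term that never makes the quadratic negative must vanish; the step
      \<open>- c / (norm y)\<^sup>2\<close>, regularised so that \<open>y = 0\<close> needs no separate case, exhibits this.\<close>
    define q where "q = (norm y)\<^sup>2 + 1"
    have q: "q > 0" "(norm y)\<^sup>2 = q - 1"
      by (auto simp: q_def intro: add_nonneg_pos)
    have "2 * (- c / q) * c + (- c / q)\<^sup>2 * (q - 1) = - (c\<^sup>2 * (q + 1)) / q\<^sup>2"
      using q(1) by (simp add: field_simps power2_eq_square)
    with ineq[of "- c / q"] q have "c\<^sup>2 * (q + 1) / q\<^sup>2 \<le> 0"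
      by simp
    then have "c = 0"
      using q(1) by (auto simp: divide_le_0_iff mult_le_0_iff)
    then show ?thesis
      by (simp add: c_def)
  qed
  then show ?thesis
    by blast
qed

text \<open>
  Riesz representation for the real part of the inner product already produces the adjoint:
  complex linearity of \<open>T\<close>, applied to \<open>\<i> *\<^sub>C x\<close>, recovers the imaginary part.
\<close>

lemma cinner_cadjoint:
  fixes T :: "'a::chilbert_space \<Rightarrow> 'b::chilbert_space"
  assumes "bounded_clinear T"
  shows "cinner (T x) y = cinner x (cadjoint T y)"
proof -
  have "\<exists>u. \<forall>x. inner (T x) y = inner x u" for y
    by (intro Riesz_representation bounded_linear_compose[OF bounded_linear_inner_left]
        bounded_clinearD assms)
  then obtain S where S: "\<And>x y. inner (T x) y = inner x (S y)"
    by metis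
  have Re: "Re (cinner (T x) y) = Re (cinner x (S y))" for x y
    using S by (simp flip: inner_eq_Re_cinner)
  have "cinner (T x) y = cinner x (S y)" for x y
  proof (rule complex_eqI)
    show "Im (cinner (T x) y) = Im (cinner x (S y))"
      using Re[of "\<i> *\<^sub>C x" y] by (simp add: bounded_clinearD(2)[OF assms] cinner_scaleC_left)
  qed (rule Re)
  then show ?thesis
    using cadjoint_eqI[of T S] by simp
qed

section \<open>Solving the commutator equation\<close>

lemma bounded_clinear_series:
  fixes G :: "nat \<Rightarrow> 'a::chilbert_space \<Rightarrow> 'b::chilbert_space"
  assumes G: "\<And>m. bounded_clinear (G m)"
    and t: "summable t"
    and bound: "\<And>m x. norm (G m x) \<le> t m * norm x"
  shows "summable (\<lambda>m. G m x)" "bounded_clinear (\<lambda>x. \<Sum>m. G m x)"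
proof -
  have s: "summable (\<lambda>m. norm (G m x))" for x
    by (rule summable_comparison_test'[OF summable_mult2[OF t, of "norm x"]]) (simp add: bound)
  show summ: "summable (\<lambda>m. G m x)" for x
    by (rule summable_norm_cancel[OF s])
  show "bounded_clinear (\<lambda>x. \<Sum>m. G m x)"
  proof (rule bounded_clinear_intro)
    show "(\<Sum>m. G m (x + y)) = (\<Sum>m. G m x) + (\<Sum>m. G m y)" for x y
      by (simp add: suminf_add summ linear_add[OF bounded_linear.linear[OF bounded_clinearD(1)[OF G]]])
    show "(\<Sum>m. G m (a *\<^sub>C x)) = a *\<^sub>C (\<Sum>m. G m x)" for a x
      by (simp add: bounded_clinearD[OF G] bounded_linear.suminf[OF bounded_linear_scaleC summ])
    show "norm (\<Sum>m. G m x) \<le> suminf t * norm x" for x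
    proof -
      have "norm (\<Sum>m. G m x) \<le> (\<Sum>m. norm (G m x))"
        by (rule summable_norm[OF s])
      also have "\<dots> \<le> (\<Sum>m. t m * norm x)"
        by (intro suminf_le bound s summable_mult2 t)
      finally show ?thesis
        by (simp add: suminf_mult2[OF t])
    qed
  qed
qed

text \<open>
  A bounded solution of \<open>A X - X B = - Y\<close> turns the triangular operator into \<open>A \<oplus> B\<close> by the
  unipotent similarity with corner \<open>X\<close>. Since \<open>A B = I\<close>, the series
  \<open>X = \<Sum>m. A\<^sup>m Y A\<^sup>m\<^sup>+\<^sup>1\<close> solves it formally: \<open>A X\<close> and \<open>X B\<close> are the same series
  \<open>\<Sum>m. A\<^sup>m Y A\<^sup>m\<close>, except that the former lacks its first term \<open>Y\<close>.
\<close>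

lemma foguel_similar_to_contraction:
  fixes A B Y :: "'k::chilbert_space \<Rightarrow> 'k"
  assumes A: "bounded_clinear A" and B: "bounded_clinear B" and Y: "bounded_clinear Y"
    and A_le: "\<And>x. norm (A x) \<le> norm x" and B_le: "\<And>x. norm (B x) \<le> norm x"
    and AB: "\<And>x. A (B x) = x"
    and t: "summable t" and decay: "\<And>m x. norm ((A ^^ m) (Y x)) \<le> t m * norm x"
  shows "similar_to_contraction (foguel A B Y)"
proof -
  have comp: "bounded_clinear (\<lambda>x. T (T' x))" if "bounded_clinear T" "bounded_clinear T'"
    for T T' :: "'k \<Rightarrow> 'k"
    using that by (auto simp: bounded_clinear_def intro: bounded_linear_compose)
  have pow: "bounded_clinear (A ^^ m)" for m
  proof (induction m)
    case 0
    then show ?case by (simp add: bounded_clinear_def)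
  next
    case (Suc m)
    then show ?case using comp[OF A Suc] by (simp add: o_def)
  qed
  have pow_le: "norm ((A ^^ m) x) \<le> norm x" for m x
    by (induction m) (auto intro: order_trans[OF A_le])
  define G where "G m x = (A ^^ m) (Y ((A ^^ m) x))" for m x
  \<comment> \<open>\<open>t\<close> can be negative only on the zero space, hence the case distinction on \<open>x\<close>.\<close>
  have t_nonneg: "0 \<le> t m * norm x" for m and x :: 'k
    by (rule order_trans[OF norm_ge_zero decay])
  have G_bound: "norm (G m x) \<le> t m * norm x" for m x
  proof (cases "x = 0")
    case False
    then have "t m \<ge> 0"
      using t_nonneg[of m x] by (simp add: zero_le_mult_iff)
    then show ?thesis
      unfolding G_def by (intro order_trans[OF decay] mult_left_mono pow_le)
  next
    case True
    then show ?thesis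
      unfolding G_def using bounded_clinearD(1)[OF Y] bounded_clinearD(1)[OF pow, of m]
      by (simp add: linear_simps)
  qed
  have G: "bounded_clinear (G m)" for m
    unfolding G_def by (rule comp[OF pow comp[OF Y pow]])
  note series = bounded_clinear_series[OF G t G_bound]
  define X where "X x = (\<Sum>m. G m (A x))" for x
  have X: "bounded_clinear X"
    unfolding X_def by (rule comp[OF series(2) A])
  have XB: "X (B x) = (\<Sum>m. G m x)" for x
    by (simp add: X_def AB)
  have "A (X x) = (\<Sum>m. G (Suc m) x)" for x
    unfolding X_def bounded_linear.suminf[OF bounded_clinearD(1)[OF A] series(1)]
    by (simp add: G_def funpow_swap1)
  then have AX: "A (X x) + Y x = X (B x)" for x
    unfolding XB using suminf_split_head[OF series(1), of x] by (simp add: G_def)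
  define L where "L = (\<lambda>(f, g). (f + X g, g))"
  define L' where "L' = (\<lambda>(f, g). (f - X g, g))"
  have tri: "bounded_clinear (\<lambda>(f, g). (P f + Q g, R g))"
    if "bounded_clinear P" "bounded_clinear Q" "bounded_clinear R" for P Q R :: "'k \<Rightarrow> 'k"
  proof -
    have "bounded_linear (\<lambda>p. (P (fst p) + Q (snd p), R (snd p)))"
      by (intro bounded_linear_Pair bounded_linear_add
          bounded_linear_compose[OF bounded_clinearD(1) bounded_linear_fst]
          bounded_linear_compose[OF bounded_clinearD(1) bounded_linear_snd] that)
    then show ?thesis
      by (auto simp: bounded_clinear_def case_prod_unfold scaleC_prod_def scaleC_add_right
          bounded_clinearD(2)[OF that(1)] bounded_clinearD(2)[OF that(2)]
          bounded_clinearD(2)[OF that(3)])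
  qed
  have ident: "bounded_clinear (\<lambda>x::'k. x)"
    by (simp add: bounded_clinear_def)
  have mX: "bounded_clinear (\<lambda>x. - X x)"
    using X by (simp add: bounded_clinear_def bounded_linear_minus scaleC_minus_right)
  have "bounded_clinear L" "bounded_clinear L'"
    unfolding L_def L'_def using tri[OF ident X ident] tri[OF ident mX ident] by simp_all
  moreover have "L \<circ> L' = id" "L' \<circ> L = id"
    by (auto simp: L_def L'_def)
  moreover have "onorm (L' \<circ> foguel A B Y \<circ> L) \<le> 1"
  proof (rule onorm_bound)
    fix p :: "'k \<times> 'k"
    obtain f g where p: "p = (f, g)"
      by (cases p)
    have "(L' \<circ> foguel A B Y \<circ> L) p = (A f, B g)"
      using AX[of g] linear_add[OF bounded_linear.linear[OF bounded_clinearD(1)[OF A]]]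
      by (simp add: p L_def L'_def foguel_def algebra_simps)
    also have "norm \<dots> \<le> norm p"
      by (auto simp: p norm_Pair intro!: real_sqrt_le_mono add_mono power_mono A_le B_le)
    finally show "norm ((L' \<circ> foguel A B Y \<circ> L) p) \<le> 1 * norm p"
      by simp
  qed simp
  moreover have "bounded_clinear (foguel A B Y)"
    unfolding foguel_def by (rule tri[OF A Y B])
  ultimately show ?thesis
    unfolding similar_to_contraction_def by blast
qed

section \<open>Hankel matrices of operators satisfying the CAR\<close>

text \<open>
  This is the source of positivity below: a Gram sum restricted to pairs with equal \<open>f\<close>-value is
  a sum of squares.
\<close>

lemma sum_inner_fibres:
  fixes v :: "'i \<Rightarrow> 'a::real_inner"
  assumes "finite J" "finite T" "f ` J \<subseteq> T"
  shows "(\<Sum>x\<in>J. \<Sum>y\<in>J. if f x = f y then inner (v x) (v y) else 0)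
    = (\<Sum>i\<in>T. (norm (\<Sum>x\<in>{x\<in>J. f x = i}. v x))\<^sup>2)"
proof -
  have "(\<Sum>i\<in>T. (norm (\<Sum>x\<in>{x\<in>J. f x = i}. v x))\<^sup>2)
      = (\<Sum>i\<in>T. \<Sum>x\<in>{x\<in>J. f x = i}. \<Sum>y\<in>{y\<in>J. f y = f x}. inner (v x) (v y))"
    unfolding power2_norm_eq_inner inner_sum_left unfolding inner_sum_right by simp
  also have "\<dots> = (\<Sum>x\<in>J. \<Sum>y\<in>{y\<in>J. f y = f x}. inner (v x) (v y))"
    by (rule sum.group[OF assms])
  also have "\<dots> = (\<Sum>x\<in>J. \<Sum>y\<in>J. if f x = f y then inner (v x) (v y) else 0)"
    by (simp add: assms sum.inter_filter eq_commute)
  finally show ?thesis ..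
qed

text \<open>
  A finite form of the fact that the Laurent matrix \<open>M\<close> with entries \<open>a (i - j) C (i - j)\<close>
  satisfies \<open>M* M + M M* = (\<Sum>p. |a p|\<^sup>2) I\<close>, with the columns reflected (\<open>j\<close> to \<open>- j\<close>) so that the
  Hankel matrix becomes the part of \<open>M\<close> in the rows \<open>i = p - j \<ge> 0\<close>. Written out on the indices
  \<open>x = (j, p)\<close>, \<open>y = (k, q)\<close>, both sums carry the coefficient \<open>a p * cnj (a q)\<close> after \<open>p\<close> and \<open>q\<close>
  are exchanged in the second one. This exchange also turns the condition \<open>p + j = q + k\<close> into
  \<open>p - j = q - k\<close>, so that the two sums pair up term by term and the CAR leaves only the terms
  with \<open>p = q\<close>, for which the condition forces \<open>j = k\<close>.
\<close>

lemma CAR_square_identity: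
  fixes C D :: "nat \<Rightarrow> 'a::complex_inner \<Rightarrow> 'a" and a :: "nat \<Rightarrow> complex" and h :: "nat \<Rightarrow> 'a"
    and N K :: nat
  assumes adj: "\<And>p x y. cinner (C p x) y = cinner x (D p y)"
    and anti: "\<And>p q x. C p (D q x) + D q (C p x) = (if p = q then x else 0)"
  defines "v \<equiv> \<lambda>(j, p). a p *\<^sub>C C p (h j)"
    and "w \<equiv> \<lambda>(j, p). cnj (a p) *\<^sub>C D p (h j)"
    and "J \<equiv> {..<N} \<times> {..<K}"
  shows "(\<Sum>x\<in>J. \<Sum>y\<in>J. if int (snd x) - int (fst x) = int (snd y) - int (fst y)
        then inner (v x) (v y) else 0)
    + (\<Sum>x\<in>J. \<Sum>y\<in>J. if snd x + fst x = snd y + fst y then inner (w x) (w y) else 0)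
    = (\<Sum>p<K. (cmod (a p))\<^sup>2) * (\<Sum>j<N. (norm (h j))\<^sup>2)" (is "?S1 + ?S2 = ?R")
proof -
  define F where "F = (\<lambda>j p k q. if int p - int j = int q - int k
      then inner (v (j, p)) (v (k, q)) else 0)"
  define G where "G = (\<lambda>j p k q. if p + j = q + k then inner (w (j, p)) (w (k, q)) else 0)"
  have adj': "cinner (D p x) y = cinner x (C p y)" for p x y
    using arg_cong[OF adj[of p y x], of cnj] by (simp flip: cinner_commute)
  have key: "F j p k q + G j q k p
      = (if q = p then if k = j then (cmod (a p))\<^sup>2 * (norm (h j))\<^sup>2 else 0 else 0)" for j p k q
  proof -
    have "cinner (v (j, p)) (v (k, q)) + cinner (w (j, q)) (w (k, p))
        = a p * cnj (a q) * cinner (C p (D q (h j)) + D q (C p (h j))) (h k)"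
      by (simp add: v_def w_def cinner_scaleC_left cinner_scaleC_right cinner_add_left adj adj'
          algebra_simps)
    also have "\<dots> = a p * cnj (a q) * (if p = q then cinner (h j) (h k) else 0)"
      by (simp add: anti)
    finally have "inner (v (j, p)) (v (k, q)) + inner (w (j, q)) (w (k, p))
        = Re (a p * cnj (a q) * (if p = q then cinner (h j) (h k) else 0))"
      by (simp only: inner_eq_Re_cinner flip: plus_complex.sel)
    moreover have "Re (a p * cnj (a p) * cinner (h j) (h j)) = (cmod (a p))\<^sup>2 * (norm (h j))\<^sup>2"
      by (simp only: cinner_self complex_norm_square[symmetric] Re_complex_of_real flip: of_real_mult)
    ultimately show ?thesis
      by (auto simp only: F_def G_def split: if_split) simp_all
  qed
  have S1: "?S1 = (\<Sum>((j, p), (k, q))\<in>J \<times> J. F j p k q)"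
    unfolding sum.cartesian_product F_def by (intro sum.cong) auto
  have "?S2 = (\<Sum>((j, p), (k, q))\<in>J \<times> J. G j p k q)"
    unfolding sum.cartesian_product G_def by (intro sum.cong) auto
  also have "\<dots> = (\<Sum>((j, p), (k, q))\<in>J \<times> J. G j q k p)"
    by (rule sum.reindex_bij_witness[where i = "\<lambda>((j, p), (k, q)). ((j, q), (k, p))"
          and j = "\<lambda>((j, p), (k, q)). ((j, q), (k, p))"]) (auto simp: J_def)
  finally have "?S1 + ?S2 = (\<Sum>((j, p), (k, q))\<in>J \<times> J. F j p k q + G j q k p)"
    unfolding S1 by (simp add: case_prod_unfold flip: sum.distrib)
  also have "\<dots> = (\<Sum>j<N. \<Sum>p<K. \<Sum>k<N. \<Sum>q<K.
      if q = p then if k = j then (cmod (a p))\<^sup>2 * (norm (h j))\<^sup>2 else 0 else 0)"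
    unfolding key J_def sum.cartesian_product
    by (rule sum.reindex_bij_witness[where i = "\<lambda>(j, p, k, q). ((j, p), (k, q))"
          and j = "\<lambda>((j, p), (k, q)). (j, p, k, q)"]) auto
  also have "\<dots> = (\<Sum>j<N. \<Sum>p<K. (cmod (a p))\<^sup>2 * (norm (h j))\<^sup>2)"
    by (intro sum.cong refl) (simp add: sum.delta)
  also have "\<dots> = ?R"
    by (simp only: sum_distrib_right[symmetric] sum_distrib_left[symmetric])
  finally show ?thesis .
qed

text \<open>
  In the square identity both sums are nonnegative, and the first one contains the square norms of
  the rows \<open>i = p - j\<close> with \<open>0 \<le> i < M\<close>. The range \<open>p < M + N\<close> is long enough for none of these
  rows to be truncated.
\<close>

lemma CAR_hankel_finite_bound:
  fixes C D :: "nat \<Rightarrow> 'a::complex_inner \<Rightarrow> 'a"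
  assumes adj: "\<And>p x y. cinner (C p x) y = cinner x (D p y)"
    and anti: "\<And>p q x. C p (D q x) + D q (C p x) = (if p = q then x else 0)"
  shows "(\<Sum>i<M. (norm (\<Sum>j<N. a (i + j) *\<^sub>C C (i + j) (h j)))\<^sup>2)
    \<le> (\<Sum>p<M + N. (cmod (a p))\<^sup>2) * (\<Sum>j<N. (norm (h j))\<^sup>2)"
proof -
  define v where "v = (\<lambda>(j, p). a p *\<^sub>C C p (h j))"
  define w where "w = (\<lambda>(j, p). cnj (a p) *\<^sub>C D p (h j))"
  define J where "J = {..<N} \<times> {..<M + N}"
  define f where "f = (\<lambda>x::nat \<times> nat. int (snd x) - int (fst x))"
  define T where "T = f ` J \<union> int ` {..<M}"
  have fin: "finite J" "finite T" "f ` J \<subseteq> T"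
    by (auto simp: J_def T_def)
  have "(\<Sum>i<M. (norm (\<Sum>j<N. a (i + j) *\<^sub>C C (i + j) (h j)))\<^sup>2)
      = (\<Sum>i<M. (norm (\<Sum>x\<in>{x\<in>J. f x = int i}. v x))\<^sup>2)"
  proof (intro sum.cong refl arg_cong[where f = "\<lambda>x. (norm x)\<^sup>2"])
    fix i assume "i \<in> {..<M}"
    then have "{x\<in>J. f x = int i} = (\<lambda>j. (j, i + j)) ` {..<N}"
      by (auto simp: J_def f_def)
    then show "(\<Sum>j<N. a (i + j) *\<^sub>C C (i + j) (h j)) = (\<Sum>x\<in>{x\<in>J. f x = int i}. v x)"
      by (simp add: sum.reindex inj_on_def v_def)
  qed
  also have "\<dots> = (\<Sum>i\<in>int ` {..<M}. (norm (\<Sum>x\<in>{x\<in>J. f x = i}. v x))\<^sup>2)"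
    by (simp add: sum.reindex)
  also have "\<dots> \<le> (\<Sum>i\<in>T. (norm (\<Sum>x\<in>{x\<in>J. f x = i}. v x))\<^sup>2)"
    using fin by (intro sum_mono2) (auto simp: T_def)
  also have "\<dots> = (\<Sum>x\<in>J. \<Sum>y\<in>J. if f x = f y then inner (v x) (v y) else 0)"
    by (rule sum_inner_fibres[OF fin, symmetric])
  also have "\<dots> \<le> (\<Sum>x\<in>J. \<Sum>y\<in>J. if f x = f y then inner (v x) (v y) else 0)
    + (\<Sum>x\<in>J. \<Sum>y\<in>J. if snd x + fst x = snd y + fst y then inner (w x) (w y) else 0)"
    unfolding sum_inner_fibres[OF fin(1) finite_imageI[OF fin(1)] order_refl,
        of "\<lambda>x. snd x + fst x" w]
    by (simp add: sum_nonneg)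
  also have "\<dots> = (\<Sum>p<M + N. (cmod (a p))\<^sup>2) * (\<Sum>j<N. (norm (h j))\<^sup>2)"
    unfolding f_def v_def w_def J_def by (rule CAR_square_identity[OF adj anti])
  finally show ?thesis .
qed

text \<open>
  Pairing the relation with \<open>x\<close> gives \<open>(norm (C x))\<^sup>2 + (norm (D x))\<^sup>2 = (norm x)\<^sup>2\<close>. The bound makes
  the row series of the Hankel matrix absolutely convergent.
\<close>

lemma CAR_contractive:
  fixes C D :: "'a::complex_inner \<Rightarrow> 'a"
  assumes adj: "\<And>x y. cinner (C x) y = cinner x (D y)"
    and anti: "\<And>x. C (D x) + D (C x) = x"
  shows "norm (C x) \<le> norm x"
proof (rule power2_le_imp_le)
  have "cinner (D x) (D x) + cinner (C x) (C x) = cinner (C (D x) + D (C x)) x"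
    unfolding cinner_add_left adj[of "D x" x] adj[of x "C x"]
    by (metis adj cinner_commute)
  then have "complex_of_real ((norm (D x))\<^sup>2 + (norm (C x))\<^sup>2) = complex_of_real ((norm x)\<^sup>2)"
    by (simp only: anti cinner_self of_real_add)
  then have "(norm (D x))\<^sup>2 + (norm (C x))\<^sup>2 = (norm x)\<^sup>2"
    using of_real_eq_iff by blast
  then show "(norm (C x))\<^sup>2 \<le> (norm x)\<^sup>2"
    using zero_le_power2[of "norm (D x)"] by linarith
qed simp

context
  fixes \<Lambda> :: "'a::chilbert_space \<Rightarrow> 'a \<Rightarrow> 'a" and e :: "nat \<Rightarrow> 'a" and \<alpha> :: "nat \<Rightarrow> complex"
  assumes CAR: "is_CAR_map \<Lambda>"
    and orthonormal: "\<And>m n. cinner (e m) (e n) = (if m = n then 1 else 0)"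
    and l2: "summable (\<lambda>k. (cmod (\<alpha> k))\<^sup>2)"
begin

lemma CAR_adjoint: "cinner (\<Lambda> u x) y = cinner x (cadjoint (\<Lambda> u) y)"
  using CAR by (intro cinner_cadjoint) (simp add: is_CAR_map_def)

lemma CAR_anticommute: "\<Lambda> (e p) (cadjoint (\<Lambda> (e q)) x) + cadjoint (\<Lambda> (e q)) (\<Lambda> (e p) x)
    = (if p = q then x else 0)"
  using CAR scaleR_scaleC[of 1 x] by (simp add: is_CAR_map_def orthonormal)

lemma clinear_coefficient: "bounded_clinear (\<lambda>x. \<alpha> k *\<^sub>C \<Lambda> (e k) x)"
proof -
  have "bounded_clinear (\<Lambda> (e k))"
    using CAR by (simp add: is_CAR_map_def)
  then show ?thesis
    by (auto simp: bounded_clinear_def scaleC_scaleC mult.commute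
        intro: bounded_linear_compose[OF bounded_linear_scaleC])
qed

lemma summable_hankel_row: "summable (\<lambda>j. \<alpha> (i + j) *\<^sub>C \<Lambda> (e (i + j)) (coord h j))"
proof (rule summable_norm_cancel, rule summable_comparison_test')
  have "summable (\<lambda>j. (cmod (\<alpha> (i + j)))\<^sup>2)"
    using summable_ignore_initial_segment[OF l2, of i] by (simp add: add.commute)
  then show "summable (\<lambda>j. (cmod (\<alpha> (i + j)))\<^sup>2 + (norm (coord h j))\<^sup>2)"
    by (intro summable_add summable_coord)
  fix j
  have "norm (\<Lambda> (e (i + j)) (coord h j)) \<le> norm (coord h j)"
    by (rule CAR_contractive[OF CAR_adjoint]) (simp add: CAR_anticommute)
  then have "norm (\<alpha> (i + j) *\<^sub>C \<Lambda> (e (i + j)) (coord h j)) \<le> cmod (\<alpha> (i + j)) * norm (coord h j)"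
    by (simp add: norm_scaleC mult_left_mono)
  also have "\<dots> \<le> (cmod (\<alpha> (i + j)))\<^sup>2 + (norm (coord h j))\<^sup>2"
    using sum_squares_bound[of "cmod (\<alpha> (i + j))" "norm (coord h j)"]
      mult_nonneg_nonneg[OF norm_ge_zero[of "\<alpha> (i + j)"] norm_ge_zero[of "coord h j"]]
    by linarith
  finally show "norm (norm (\<alpha> (i + j) *\<^sub>C \<Lambda> (e (i + j)) (coord h j)))
      \<le> (cmod (\<alpha> (i + j)))\<^sup>2 + (norm (coord h j))\<^sup>2"
    by simp
qed

lemma hankel_rows_bound:
  "(\<Sum>i<M. (norm (\<Sum>j. \<alpha> (i + j) *\<^sub>C \<Lambda> (e (i + j)) (coord h j)))\<^sup>2)
    \<le> (\<Sum>k. (cmod (\<alpha> k))\<^sup>2) * (norm h)\<^sup>2"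
proof (rule LIMSEQ_le_const2)
  show "(\<lambda>N. \<Sum>i<M. (norm (\<Sum>j<N. \<alpha> (i + j) *\<^sub>C \<Lambda> (e (i + j)) (coord h j)))\<^sup>2)
      \<longlonglongrightarrow> (\<Sum>i<M. (norm (\<Sum>j. \<alpha> (i + j) *\<^sub>C \<Lambda> (e (i + j)) (coord h j)))\<^sup>2)"
    by (rule tendsto_sum, rule tendsto_power, rule tendsto_norm,
        rule summable_LIMSEQ[OF summable_hankel_row])
  have "(\<Sum>i<M. (norm (\<Sum>j<N. \<alpha> (i + j) *\<^sub>C \<Lambda> (e (i + j)) (coord h j)))\<^sup>2)
      \<le> (\<Sum>k. (cmod (\<alpha> k))\<^sup>2) * (norm h)\<^sup>2" for N
    by (rule order_trans[OF CAR_hankel_finite_bound[OF CAR_adjoint CAR_anticommute]])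
      (intro mult_mono sum_coord_le_norm sum_le_suminf l2 suminf_nonneg sum_nonneg;
        simp)
  then show "\<exists>N. \<forall>n\<ge>N. (\<Sum>i<M. (norm (\<Sum>j<n. \<alpha> (i + j) *\<^sub>C \<Lambda> (e (i + j)) (coord h j)))\<^sup>2)
      \<le> (\<Sum>k. (cmod (\<alpha> k))\<^sup>2) * (norm h)\<^sup>2"
    by blast
qed

lemma square_summable_hankel:
  "summable (\<lambda>i. (norm (\<Sum>j. \<alpha> (i + j) *\<^sub>C \<Lambda> (e (i + j)) (coord h j)))\<^sup>2)"
  by (rule summableI_nonneg_bounded[OF _ hankel_rows_bound]) simp

lemma coord_CAR_hankel:
  "coord (CAR_hankel \<Lambda> e \<alpha> h) i = (\<Sum>j. \<alpha> (i + j) *\<^sub>C \<Lambda> (e (i + j)) (coord h j))"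
  unfolding CAR_hankel_def matrix_op_def
  by (subst Abs_l2_inverse, rule CollectI, rule square_summable_hankel, rule refl)

lemma norm_CAR_hankel_le:
  "norm (CAR_hankel \<Lambda> e \<alpha> h) \<le> sqrt (\<Sum>k. (cmod (\<alpha> k))\<^sup>2) * norm h"
proof (rule power2_le_imp_le)
  have nonneg: "0 \<le> (\<Sum>k. (cmod (\<alpha> k))\<^sup>2)"
    by (intro suminf_nonneg l2) simp
  then show "0 \<le> sqrt (\<Sum>k. (cmod (\<alpha> k))\<^sup>2) * norm h"
    by simp
  have "(norm (CAR_hankel \<Lambda> e \<alpha> h))\<^sup>2 \<le> (\<Sum>k. (cmod (\<alpha> k))\<^sup>2) * (norm h)\<^sup>2"
    unfolding norm_l2_power2[of "CAR_hankel \<Lambda> e \<alpha> h"] coord_CAR_hankel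
    by (rule suminf_le_const[OF square_summable_hankel hankel_rows_bound])
  then show "(norm (CAR_hankel \<Lambda> e \<alpha> h))\<^sup>2 \<le> (sqrt (\<Sum>k. (cmod (\<alpha> k))\<^sup>2) * norm h)\<^sup>2"
    unfolding power_mult_distrib real_sqrt_pow2[OF nonneg] .
qed

lemma bounded_clinear_CAR_hankel: "bounded_clinear (CAR_hankel \<Lambda> e \<alpha>)"
proof (rule bounded_clinear_intro[OF _ _ norm_CAR_hankel_le])
  show "CAR_hankel \<Lambda> e \<alpha> (f + g) = CAR_hankel \<Lambda> e \<alpha> f + CAR_hankel \<Lambda> e \<alpha> g" for f g
    by (rule l2_eqI) (simp add: coord_CAR_hankel plus_l2.rep_eq suminf_add summable_hankel_row
        linear_add[OF bounded_linear.linear[OF bounded_clinearD(1)[OF clinear_coefficient]]])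
  show "CAR_hankel \<Lambda> e \<alpha> (c *\<^sub>C h) = c *\<^sub>C CAR_hankel \<Lambda> e \<alpha> h" for c h
    by (rule l2_eqI) (simp add: coord_CAR_hankel scaleC_l2.rep_eq bounded_clinearD(2)[OF clinear_coefficient]
        bounded_linear.suminf[OF bounded_linear_scaleC summable_hankel_row])
qed

end

lemma coord_cadjoint_shift_pow: "coord ((cadjoint shift ^^ m) h) n = coord h (m + n)"
  by (induction m arbitrary: n) (simp_all add: coord_cadjoint_shift)

text \<open>
  A backward shift of a Hankel matrix is the Hankel matrix of the shifted symbol, whose
  coefficients are those of the same CAR family with the first ones dropped. Hence the norms of
  the operators \<open>S*\<^sup>m Y\<close> are controlled by the tails of \<open>\<alpha>\<close>.
\<close>

lemma norm_cadjoint_shift_pow_CAR_hankel_le: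
  fixes \<Lambda> :: "'a::chilbert_space \<Rightarrow> 'a \<Rightarrow> 'a"
  assumes CAR: "is_CAR_map \<Lambda>"
    and orthonormal: "\<And>m n. cinner (e m) (e n) = (if m = n then 1 else 0)"
    and l2: "summable (\<lambda>k. (cmod (\<alpha> k))\<^sup>2)"
  shows "norm ((cadjoint shift ^^ m) (CAR_hankel \<Lambda> e \<alpha> h))
    \<le> sqrt (\<Sum>k. (cmod (\<alpha> (m + k)))\<^sup>2) * norm h"
proof -
  have orth: "cinner (e (m + i)) (e (m + j)) = (if i = j then 1 else 0)" for i j
    by (simp add: orthonormal)
  have tail: "summable (\<lambda>k. (cmod (\<alpha> (m + k)))\<^sup>2)"
    using summable_ignore_initial_segment[OF l2, of m] by (simp add: add.commute)
  have "(cadjoint shift ^^ m) (CAR_hankel \<Lambda> e \<alpha> h)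
      = CAR_hankel \<Lambda> (\<lambda>k. e (m + k)) (\<lambda>k. \<alpha> (m + k)) h"
    by (rule l2_eqI) (simp add: coord_cadjoint_shift_pow coord_CAR_hankel[OF CAR orthonormal l2]
        coord_CAR_hankel[OF CAR orth tail] add.assoc)
  then show ?thesis
    using norm_CAR_hankel_le[OF CAR orth tail] by simp
qed

section \<open>Summability of the tails\<close>

lemma sqrt_tail_le:
  fixes r b :: "nat \<Rightarrow> real"
  assumes pos: "0 < r m" and mono: "\<And>k. k \<ge> m \<Longrightarrow> r m \<le> r k"
    and summ: "summable (\<lambda>k. (r k)\<^sup>2 * (b k)\<^sup>2)"
  shows "sqrt (\<Sum>k. (b (m + k))\<^sup>2) \<le> sqrt (\<Sum>k. (r k)\<^sup>2 * (b k)\<^sup>2) / r m"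
proof -
  have summ': "summable (\<lambda>k. (r (m + k))\<^sup>2 * (b (m + k))\<^sup>2)"
    using summable_ignore_initial_segment[OF summ, of m] by (simp add: add.commute)
  have le: "(r m)\<^sup>2 * (b (m + k))\<^sup>2 \<le> (r (m + k))\<^sup>2 * (b (m + k))\<^sup>2" for k
    using pos mono by (intro mult_right_mono power_mono) auto
  have summ'': "summable (\<lambda>k. (r m)\<^sup>2 * (b (m + k))\<^sup>2)"
    by (rule summable_comparison_test'[OF summ']) (use le in auto)
  have "(r m)\<^sup>2 * (\<Sum>k. (b (m + k))\<^sup>2) = (\<Sum>k. (r m)\<^sup>2 * (b (m + k))\<^sup>2)"
    using pos summ'' by (intro suminf_mult[symmetric]) (simp add: summable_cmult_iff)
  also have "\<dots> \<le> (\<Sum>k. (r (m + k))\<^sup>2 * (b (m + k))\<^sup>2)"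
    by (intro suminf_le le summ' summ'')
  also have "\<dots> \<le> (\<Sum>k. (r k)\<^sup>2 * (b k)\<^sup>2)"
    using suminf_split_initial_segment[OF summ, of m]
      sum_nonneg[of "{..<m}" "\<lambda>k. (r k)\<^sup>2 * (b k)\<^sup>2"] by (simp add: add.commute)
  finally have "sqrt ((r m)\<^sup>2 * (\<Sum>k. (b (m + k))\<^sup>2)) \<le> sqrt (\<Sum>k. (r k)\<^sup>2 * (b k)\<^sup>2)"
    by (rule real_sqrt_le_mono)
  then show ?thesis
    using pos by (simp add: real_sqrt_mult field_simps)
qed

text \<open>
  The reciprocals at the integers are the terms of Bertrand's series. With \<open>\<delta> = \<epsilon> / 2\<close>, the
  weight of \<open>|\<alpha> k|\<^sup>2\<close> in the theorem is the square of \<open>bertrand \<delta> (k + 1)\<close>.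
\<close>

definition bertrand :: "real \<Rightarrow> real \<Rightarrow> real"
  where "bertrand \<delta> x = x * ln x * ln (ln x) powr (1 + \<delta>)"

lemma ln_ln_pos:
  fixes x :: real
  assumes "x \<ge> 3"
  shows "1 < ln x" "0 < ln (ln x)"
proof -
  have "exp 1 < x"
    using e_less_272 assms by linarith
  then have "ln (exp 1) < ln x"
    using assms by (subst ln_less_cancel_iff) auto
  then show "1 < ln x" "0 < ln (ln x)"
    by simp_all
qed

lemma bertrand_pos: "x \<ge> 3 \<Longrightarrow> 0 < bertrand \<delta> x"
  using ln_ln_pos[of x] by (simp add: bertrand_def)

lemma bertrand_mono:
  assumes "\<delta> > 0" "3 \<le> x" "x \<le> y"
  shows "bertrand \<delta> x \<le> bertrand \<delta> y"
  using assms ln_ln_pos[of x] ln_ln_pos[of y] unfolding bertrand_def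
  by (intro mult_mono powr_mono2) auto

text \<open>
  The function \<open>- (ln (ln x)) powr (- \<delta>) / \<delta>\<close> is a primitive of \<open>1 / bertrand \<delta> x\<close> and tends
  to \<open>0\<close>; the mean value theorem bounds the terms by a telescoping series.
\<close>

lemma summable_bertrand:
  assumes "\<delta> > 0"
  shows "summable (\<lambda>n. 1 / bertrand \<delta> (real n + 4))"
proof -
  define F where "F x = ln (ln x) powr (- \<delta>)" for x :: real
  have deriv: "(F has_real_derivative - \<delta> / bertrand \<delta> x) (at x)" if "x \<ge> 3" for x
  proof -
    have "(F has_real_derivative - \<delta> * ln (ln x) powr (- \<delta> - 1) * (1 / x / ln x)) (at x)"
      unfolding F_def using ln_ln_pos[OF that] that
      by (auto intro!: derivative_eq_intros simp: field_simps)
    moreover have "ln (ln x) powr (- \<delta> - 1) = 1 / ln (ln x) powr (1 + \<delta>)"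
      unfolding powr_minus_divide[symmetric] by (rule arg_cong) simp
    ultimately show ?thesis
      by (simp add: bertrand_def mult_ac)
  qed
  \<comment> \<open>The terms start at \<open>4\<close> because the interval to the left of each of them has to lie in
    the region \<open>x \<ge> 3\<close>, where \<open>ln (ln x)\<close> is positive.\<close>
  have step: "\<delta> / bertrand \<delta> (real n + 4) \<le> F (real n + 3) - F (real n + 4)" for n
  proof -
    obtain z where z: "real n + 3 < z" "z < real n + 4"
      "F (real n + 4) - F (real n + 3) = (real n + 4 - (real n + 3)) * (- \<delta> / bertrand \<delta> z)"
      using MVT2[of "real n + 3" "real n + 4" F "\<lambda>x. - \<delta> / bertrand \<delta> x"] deriv by auto
    moreover have "\<delta> / bertrand \<delta> (real n + 4) \<le> \<delta> / bertrand \<delta> z"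
      using z assms by (intro divide_left_mono mult_pos_pos bertrand_pos bertrand_mono) auto
    ultimately show ?thesis
      by simp
  qed
  have "(\<lambda>n. F (real n + 3)) \<longlonglongrightarrow> 0"
    unfolding F_def using assms
    by (intro tendsto_neg_powr filterlim_compose[OF ln_at_top]
        filterlim_tendsto_add_at_top[OF tendsto_const, of _ _ 3, unfolded add.commute[of 3]]
        filterlim_real_sequentially) auto
  from telescope_summable'[OF this]
  have "summable (\<lambda>n. F (real n + 3) - F (real n + 4))"
    by (simp add: add.commute add.left_commute)
  then have "summable (\<lambda>n. \<delta> / bertrand \<delta> (real n + 4))"
    by (rule summable_comparison_test') (use step bertrand_pos assms in \<open>auto simp: less_imp_le\<close>)
  then have "summable (\<lambda>n. inverse \<delta> * (\<delta> / bertrand \<delta> (real n + 4)))"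
    by (rule summable_mult)
  then show ?thesis
    using assms by (simp add: field_simps)
qed

lemma summable_on_atLeast_imp_summable:
  fixes f :: "nat \<Rightarrow> real"
  assumes "f summable_on {m..}"
  shows "summable (\<lambda>n. if n \<ge> m then f n else 0)"
proof (rule summable_on_imp_summable)
  show "(\<lambda>n. if n \<ge> m then f n else 0) summable_on UNIV"
    using assms by (rule summable_on_cong_neutral[THEN iffD1, rotated -1]) auto
qed

section \<open>Similarity to a contraction\<close>

lemma bounded_clinear_shift: "bounded_clinear (shift :: 'a::complex_inner l2 \<Rightarrow> 'a l2)"
  and norm_shift_le: "norm (shift h) \<le> norm (h :: 'a l2)"
proof -
  have "(norm (shift h))\<^sup>2 = (norm h)\<^sup>2" for h :: "'a l2"
    unfolding norm_l2_power2
    using suminf_split_head[OF summable_coord[of "shift h"]] by (simp add: shift.rep_eq)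
  then show le: "norm (shift h) \<le> norm h" for h :: "'a l2"
    by (simp add: power2_eq_iff_nonneg)
  show "bounded_clinear (shift :: 'a l2 \<Rightarrow> 'a l2)"
  proof (rule bounded_clinear_intro[where K = 1])
    show "shift (f + g) = shift f + shift g" for f g :: "'a l2"
      by (rule l2_eqI) (simp add: shift.rep_eq plus_l2.rep_eq split: nat.split)
    show "shift (a *\<^sub>C f) = a *\<^sub>C shift f" for a and f :: "'a l2"
      by (intro l2_eqI) (simp add: shift.rep_eq scaleC_l2.rep_eq split: nat.split)
  qed (simp add: le)
qed

lemma bounded_clinear_cadjoint_shift:
    "bounded_clinear (cadjoint shift :: 'a::chilbert_space l2 \<Rightarrow> 'a l2)"
  and norm_cadjoint_shift_le: "norm (cadjoint shift h) \<le> norm (h :: 'a l2)"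
proof -
  show le: "norm (cadjoint shift h) \<le> norm h" for h :: "'a l2"
  proof (rule power2_le_imp_le)
    show "(norm (cadjoint shift h))\<^sup>2 \<le> (norm h)\<^sup>2"
      unfolding norm_l2_power2 coord_cadjoint_shift
      using suminf_split_head[OF summable_coord[of h]] by simp
  qed simp
  show "bounded_clinear (cadjoint shift :: 'a l2 \<Rightarrow> 'a l2)"
  proof (rule bounded_clinear_intro[where K = 1])
    show "cadjoint shift (f + g) = cadjoint shift f + cadjoint shift g" for f g :: "'a l2"
      by (rule l2_eqI) (simp add: coord_cadjoint_shift plus_l2.rep_eq)
    show "cadjoint shift (a *\<^sub>C f) = a *\<^sub>C cadjoint shift f" for a and f :: "'a l2"
      by (rule l2_eqI) (simp add: coord_cadjoint_shift scaleC_l2.rep_eq)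
  qed (simp add: le)
qed

lemma cadjoint_shift_shift: "cadjoint shift (shift h) = h"
  by (rule l2_eqI) (simp add: coord_cadjoint_shift shift.rep_eq)

theorem theorem2p3:
  fixes \<Lambda> :: "'a::chilbert_space \<Rightarrow> 'a \<Rightarrow> 'a"
    and e :: "nat \<Rightarrow> 'a"
    and \<epsilon> :: real
    and \<alpha> :: "nat \<Rightarrow> complex"
  assumes CAR: "is_CAR_map \<Lambda>"
    and basis: "is_orthonormal_basis e"
    and eps: "\<epsilon> > 0"
    and l2: "summable (\<lambda>k. (cmod (\<alpha> k))\<^sup>2)"
    and weighted: "(\<lambda>k. (real k + 1)\<^sup>2 * (ln (real k + 1))\<^sup>2
        * ln (ln (real k + 1)) powr (2 + \<epsilon>) * (cmod (\<alpha> k))\<^sup>2) summable_on {2..}"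
  shows "similar_to_contraction (foguel (cadjoint shift) shift (CAR_hankel \<Lambda> e \<alpha>))"
proof -
  define \<delta> where "\<delta> = \<epsilon> / 2"
  have \<delta>: "\<delta> > 0"
    using eps by (simp add: \<delta>_def)
  have orthonormal: "cinner (e m) (e n) = (if m = n then 1 else 0)" for m n
    using basis by (simp add: is_orthonormal_basis_def)
  \<comment> \<open>The square root of the weight, which makes sense where \<open>ln (ln (k + 1))\<close> is positive.\<close>
  define r where "r k = (if k \<ge> 2 then bertrand \<delta> (real k + 1) else 0)" for k :: nat
  have weight: "(real k + 1)\<^sup>2 * (ln (real k + 1))\<^sup>2 * ln (ln (real k + 1)) powr (2 + \<epsilon>)
      = (r k)\<^sup>2" if "k \<ge> 2" for k
  proof -
    have "ln (ln (real k + 1)) powr (2 + \<epsilon>) = (ln (ln (real k + 1)) powr (1 + \<delta>))\<^sup>2"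
      by (simp add: \<delta>_def power2_eq_square flip: powr_add)
    then show ?thesis
      using that by (simp add: r_def bertrand_def power_mult_distrib)
  qed
  have "summable (\<lambda>k. (r k)\<^sup>2 * (cmod (\<alpha> k))\<^sup>2)"
    by (rule summable_on_atLeast_imp_summable[OF weighted, THEN summable_cong[THEN iffD1, rotated]])
       (auto simp: weight r_def intro!: always_eventually)
  note tail = sqrt_tail_le[OF _ _ this]
  define t where "t m = sqrt (\<Sum>k. (cmod (\<alpha> (m + k)))\<^sup>2)" for m
  define W where "W = sqrt (\<Sum>k. (r k)\<^sup>2 * (cmod (\<alpha> k))\<^sup>2)"
  have t_nonneg: "0 \<le> t m" for m
    unfolding t_def using summable_ignore_initial_segment[OF l2, of m]
    by (simp add: suminf_nonneg add.commute)
  have "t (n + 3) \<le> W * (1 / bertrand \<delta> (real n + 4))" for n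
  proof -
    have "t (n + 3) \<le> W / r (n + 3)"
      unfolding t_def W_def using \<delta>
      by (intro tail) (auto simp: r_def intro!: bertrand_pos bertrand_mono)
    then show ?thesis
      by (simp add: r_def add.commute)
  qed
  then have "summable (\<lambda>n. t (n + 3))"
    by (intro summable_comparison_test'[OF summable_mult[OF summable_bertrand[OF \<delta>], of W]])
       (simp add: t_nonneg)
  then have "summable t"
    by (simp only: summable_iff_shift)
  then show ?thesis
    by (rule foguel_similar_to_contraction[OF bounded_clinear_cadjoint_shift bounded_clinear_shift
          bounded_clinear_CAR_hankel[OF CAR orthonormal l2] norm_cadjoint_shift_le norm_shift_le
          cadjoint_shift_shift])
       (unfold t_def, rule norm_cadjoint_shift_pow_CAR_hankel_le[OF CAR orthonormal l2])
qed

end
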